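(* Let $G=(V,E)$ be a graph, and let $D:V\to\mathbb{N}$ be such that $\deg(G,v)\leq D(v)$ for all $v\in V$. Fix $0\leq\alpha<\pi/2$. For each $v\in V$, let $\mathbf{u}^{(v)}=\{u^{(v)}_0,u^{(v)}_1,\ldots\}$ be a sequence of nonnegative real numbers such that $$\Gamma(D(v),\mathbf{u}^{(v)},y):=\sum_{k=0}^{D(v)}\binom{D(v)}{k}u^{(v)}_k y^k$$ is $\mathcal{S}[\pi-\alpha]$-nonvanishing. Then the univariate polynomial $\sum_{j}N(G;\{\mathbf{u}^{(v)}\},j)\,t^{j}$ is $\mathcal{S}[\pi-2\alpha]$-nonvanishing.
   Context: A graph $G=(V,E)$ is a finite undirected multigraph (loops and multiple edges allowed); $\mathbb{N}$ includes $0$. Spanning subgraphs are identified with edge subsets $H\subseteq E$; $\deg(H,v)$ is the degree of $v$ in $(V,H)$, a loop contributing $2$, and $\deg(G,v)=\deg(E,v)$. For $H\subseteq E$, $\mathbf{u}_{\deg(H)}:=\prod_{v\in V}u^{(v)}_{\deg(H,v)}$, and for $j\in\mathbb{N}$, $N(G;\{\mathbf{u}^{(v)}\},j):=\sum_{H\subseteq E:\ \#H=j}\mathbf{u}_{\deg(H)}$. For an open set $\mathcal{A}\subset\mathbb{C}$, a univariate complex polynomial $F$ is $\mathcal{A}$-nonvanishing if either $F\equiv 0$, or $F(z)\neq 0$ for all $z\in\mathcal{A}$. For $0<\theta\leq\pi$, $\mathcal{S}[\theta]:=\{z\in\mathbb{C}: z\neq 0 \text{ and } |\arg(z)|<\theta\}$,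 with $-\pi<\arg(z)\leq\pi$. *)

theory Defs
  imports
    Complex_Main
    "HOL-Library.Uprod"
    "HOL-Computational_Algebra.Polynomial"
begin

(* Edges carry their own identity, so parallel edges are distinct elements of edges G
   with the same end pair; a loop at v is an edge with end pair Upair v v. *)
record ('v, 'e) ugraph =
  verts :: "'v set"
  edges :: "'e set"
  ends :: "'e \<Rightarrow> 'v uprod"

locale finite_multigraph =
  fixes G :: "('v, 'e) ugraph"
  assumes finite_verts: "finite (verts G)"
    and finite_edges: "finite (edges G)"
    and ends_in_verts: "\<And>e. e \<in> edges G \<Longrightarrow> set_uprod (ends G e) \<subseteq> verts G"

(* The second summand counts the loops at v a second time. *)
definition sub_degree :: "('v, 'e) ugraph \<Rightarrow> 'e set \<Rightarrow> 'v \<Rightarrow> nat" where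
  "sub_degree G H v =
     card {e \<in> H. v \<in> set_uprod (ends G e)} + card {e \<in> H. ends G e = Upair v v}"

definition degree_weight :: "('v, 'e) ugraph \<Rightarrow> ('v \<Rightarrow> nat \<Rightarrow> real) \<Rightarrow> 'e set \<Rightarrow> real" where
  "degree_weight G u H = (\<Prod>v\<in>verts G. u v (sub_degree G H v))"

definition weighted_count :: "('v, 'e) ugraph \<Rightarrow> ('v \<Rightarrow> nat \<Rightarrow> real) \<Rightarrow> nat \<Rightarrow> real" where
  "weighted_count G u j = (\<Sum>H | H \<subseteq> edges G \<and> card H = j. degree_weight G u H)"

(* The coefficients vanish for j > card (edges G). *)
definition count_poly :: "('v, 'e) ugraph \<Rightarrow> ('v \<Rightarrow> nat \<Rightarrow> real) \<Rightarrow> complex poly" where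
  "count_poly G u = (\<Sum>j\<le>card (edges G). monom (complex_of_real (weighted_count G u j)) j)"

definition Gamma_poly :: "nat \<Rightarrow> (nat \<Rightarrow> real) \<Rightarrow> complex poly" where
  "Gamma_poly d u = (\<Sum>k\<le>d. monom (of_nat (d choose k) * complex_of_real (u k)) k)"

definition nonvanishing :: "complex set \<Rightarrow> complex poly \<Rightarrow> bool" where
  "nonvanishing A F \<longleftrightarrow> F = 0 \<or> (\<forall>z\<in>A. poly F z \<noteq> 0)"

definition sector :: "real \<Rightarrow> complex set" where
  "sector \<theta> = {z. z \<noteq> 0 \<and> \<bar>Arg z\<bar> < \<theta>}"

end

theory Submission
  imports
    Defs
    "HOL-Complex_Analysis.Complex_Analysis"
    "HOL-Computational_Algebra.Fundamental_Theorem_Algebra"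
begin

text \<open>Write \<open>t = s\<^sup>2\<close>. Then \<open>t\<close> lies in the sector of half-angle \<open>\<pi> - 2\<alpha>\<close> iff \<open>s\<close> can be taken
  in the sector of half-angle \<open>\<pi>/2 - \<alpha>\<close>, and for such \<open>s\<close> the polynomial with weights \<open>s\<^sup>k u\<^sub>k\<close> at
  each vertex has no zero in the open right half-plane. By Grace--Walsh--Szego its polarization, a
  polynomial in one variable per half-edge, has none either; the \<open>D v - deg v\<close> surplus variables
  are set to \<open>\<epsilon> > 0\<close>. The Lieb--Sokal operators \<open>1 + \<partial>\<^sub>i \<partial>\<^sub>j\<close>, one for each edge with half-edges \<open>i\<close>
  and \<open>j\<close>, preserve this. Evaluating at \<open>\<epsilon>\<close> and letting \<open>\<epsilon>\<close> tend to 0 selects the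
  unions of complete edges, each edge counted with \<open>s\<^sup>2 = t\<close>; the limit is handled by Hurwitz's theorem.\<close>

section \<open>Laguerre's theorem for binomially normalized polynomials\<close>

definition binom_poly :: "nat \<Rightarrow> (nat \<Rightarrow> complex) \<Rightarrow> complex poly" where
  "binom_poly n w = (\<Sum>k\<le>n. monom (of_nat (n choose k) * w k) k)"

definition hurwitz_stable :: "nat \<Rightarrow> (nat \<Rightarrow> complex) \<Rightarrow> bool" where
  "hurwitz_stable n w \<longleftrightarrow> (\<forall>y. 0 < Re y \<longrightarrow> poly (binom_poly n w) y \<noteq> 0)"

text \<open>The polarization of \<open>binom_poly n w\<close> sums, over subsets \<open>S\<close> of
  \<open>n\<close> variables, \<open>w (card S)\<close> times the product of the variables in
  \<open>S\<close>. Setting one variable to \<open>x\<close> leaves such a sum in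
  \<open>n - 1\<close> variables with the weights \<open>polar_step x w\<close>.\<close>

definition polar_step :: "complex \<Rightarrow> (nat \<Rightarrow> complex) \<Rightarrow> nat \<Rightarrow> complex" where
  "polar_step x w k = w k + x * w (Suc k)"

lemma poly_binom_poly: "poly (binom_poly n w) y = (\<Sum>k\<le>n. of_nat (n choose k) * w k * y ^ k)"
  by (simp add: binom_poly_def poly_sum poly_monom)

lemma degree_binom_poly_le: "degree (binom_poly n w) \<le> n"
  unfolding binom_poly_def
  by (rule degree_sum_le) (auto intro: order_trans[OF degree_monom_le])

lemma poly_binom_poly_Suc:
  "poly (binom_poly (Suc m) w) y = poly (binom_poly m (polar_step y w)) y"
proof -
  have "(\<Sum>k\<le>m. of_nat (m choose Suc k) * w (Suc k) * y ^ Suc k) =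
        (\<Sum>k=1..Suc m. of_nat (m choose k) * w k * y ^ k)"
    by (rule sum.reindex_bij_witness[of _ "\<lambda>k. k - 1" Suc]) auto
  also have "\<dots> = (\<Sum>k=1..m. of_nat (m choose k) * w k * y ^ k)"
    by simp
  finally have "w 0 + (\<Sum>k\<le>m. of_nat (m choose Suc k) * w (Suc k) * y ^ Suc k) =
        (\<Sum>k\<le>m. of_nat (m choose k) * w k * y ^ k)"
    by (simp add: sum.atMost_shift sum.atLeast1_atMost_eq lessThan_Suc_atMost)
  then show ?thesis
    unfolding poly_binom_poly polar_step_def
    by (subst sum.atMost_Suc_shift) (simp add: algebra_simps sum.distrib)
qed

lemma poly_pderiv_binom_poly_Suc:
  "poly (pderiv (binom_poly (Suc m) w)) y = of_nat (Suc m) * poly (binom_poly m (\<lambda>k. w (Suc k))) y"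
proof -
  have "poly (pderiv (binom_poly (Suc m) w)) y =
        (\<Sum>k\<le>Suc m. of_nat k * of_nat (Suc m choose k) * w k * y ^ (k - 1))"
    unfolding binom_poly_def higher_pderiv_sum[of 1, simplified] poly_sum
    by (simp add: pderiv_monom poly_monom mult.assoc)
  also have "\<dots> = (\<Sum>k\<le>m. of_nat (Suc k * (Suc m choose Suc k)) * w (Suc k) * y ^ k)"
    by (subst sum.atMost_Suc_shift) (simp only: of_nat_mult of_nat_0 mult_zero_left diff_Suc_1 add_0)
  also have "\<dots> = (\<Sum>k\<le>m. of_nat (Suc m * (m choose k)) * w (Suc k) * y ^ k)"
    unfolding Suc_times_binomial ..
  also have "\<dots> = of_nat (Suc m) * poly (binom_poly m (\<lambda>k. w (Suc k))) y"
    unfolding poly_binom_poly sum_distrib_left of_nat_mult by (simp only: mult.assoc)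
  finally show ?thesis .
qed

text \<open>Every root \<open>r\<close> has \<open>Re r \<le> 0\<close>, so
  \<open>1 / (y - r)\<close> lies in the disc with centre and radius \<open>1 / (2 * Re y)\<close>.
  The logarithmic derivative is the sum of these points; the induction splits off one linear factor
  at a time.\<close>

lemma norm_log_derivative_le:
  fixes p :: "complex poly"
  assumes "\<And>z. 0 < Re z \<Longrightarrow> poly p z \<noteq> 0" and "0 < Re y"
  shows "cmod (2 * Re y * poly (pderiv p) y / poly p y - degree p) \<le> degree p"
  using assms(1)
proof (induction "degree p" arbitrary: p)
  case 0
  then have "pderiv p = 0"
    by (simp add: pderiv_eq_0_iff)
  then show ?case using "0.hyps" by simp
next
  case (Suc m)
  then have "\<not> constant (poly p)"
    by (simp add: constant_degree)
  then obtain r where r: "poly p r = 0"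
    using fundamental_theorem_of_algebra by blast
  then obtain q where q: "p = [:- r, 1:] * q"
    by (metis dvdE poly_eq_0_iff_dvd)
  have nz: "poly q z \<noteq> 0" if "0 < Re z" for z
    using Suc.prems[OF that] q by auto
  have "q \<noteq> 0"
    using nz[of 1] by auto
  then have deg: "degree p = Suc (degree q)"
    unfolding q by (subst degree_mult_eq) auto
  have IH: "cmod (2 * Re y * poly (pderiv q) y / poly q y - degree q) \<le> degree q"
    using Suc.hyps deg nz by auto
  have r0: "Re r \<le> 0"
    using Suc.prems[of r] r by force
  have yr: "y - r \<noteq> 0"
    using r0 assms(2) by auto
  have "(cmod (2 * Re y - (y - r)))\<^sup>2 \<le> (cmod (y - r))\<^sup>2"
    using mult_nonneg_nonpos[of "Re y" "Re r"] r0 assms(2)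
    unfolding cmod_power2 by (simp add: power2_eq_square algebra_simps)
  then have "cmod (2 * Re y - (y - r)) \<le> cmod (y - r)"
    using power2_le_imp_le norm_ge_zero by blast
  moreover have "2 * Re y / (y - r) - 1 = (2 * Re y - (y - r)) / (y - r)"
    using yr by (simp add: field_simps)
  ultimately have one: "cmod (2 * Re y / (y - r) - 1) \<le> 1"
    using yr by (simp add: norm_divide)
  have "2 * Re y * poly (pderiv p) y / poly p y =
        2 * Re y / (y - r) + 2 * Re y * poly (pderiv q) y / poly q y"
    using yr nz[OF assms(2)] unfolding q pderiv_mult
    by (simp add: pderiv_pCons field_simps)
  then have "2 * Re y * poly (pderiv p) y / poly p y - degree p =
        (2 * Re y / (y - r) - 1) + (2 * Re y * poly (pderiv q) y / poly q y - degree q)"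
    unfolding deg by simp
  also have "cmod \<dots> \<le> 1 + degree q"
    by (rule order_trans[OF norm_triangle_ineq]) (use one IH in linarith)
  finally show ?case
    unfolding deg by simp
qed

text \<open>Laguerre: the average of the \<open>n\<close> numbers \<open>1 / (y - r)\<close>, \<open>r\<close> ranging over the roots
  (those at infinity contributing 0), lies in a disc that does not contain \<open>1 / (y - x)\<close>.\<close>

lemma hurwitz_stable_polar_step:
  assumes "hurwitz_stable (Suc m) w" and x: "0 < Re x"
  shows "hurwitz_stable m (polar_step x w)"
  unfolding hurwitz_stable_def
proof (intro allI impI notI)
  fix y :: complex
  assume y: "0 < Re y" and zero: "poly (binom_poly m (polar_step x w)) y = 0"
  define p where "p = binom_poly (Suc m) w"
  define n where "n = Suc m"
  have nz: "poly p z \<noteq> 0" if "0 < Re z" for z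
    using assms(1) that by (auto simp: hurwitz_stable_def p_def)
  have lin: "poly (binom_poly m (polar_step z w)) y =
      poly (binom_poly m w) y + z * poly (binom_poly m (\<lambda>k. w (Suc k))) y" for z
    by (simp add: poly_binom_poly polar_step_def sum.distrib sum_distrib_left algebra_simps)
  \<comment> \<open>The left side is the polar derivative of \<open>p\<close> with pole
    \<open>x\<close>. Its vanishing at \<open>y\<close> forces the logarithmic derivative there to
    be \<open>n / (y - x)\<close>.\<close>
  have "n * poly p y + (x - y) * poly (pderiv p) y = n * poly (binom_poly m (polar_step x w)) y"
    unfolding p_def n_def poly_pderiv_binom_poly_Suc poly_binom_poly_Suc lin
    by (simp add: algebra_simps)
  then have eq: "n * poly p y = (y - x) * poly (pderiv p) y"
    unfolding zero by (simp add: algebra_simps add_eq_0_iff2)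
  have n0: "0 < n" by (simp add: n_def)
  have yx: "y - x \<noteq> 0"
    using eq nz[OF y] n0 by auto
  define w' where "w' = poly (pderiv p) y / poly p y"
  have w': "w' = n / (y - x)"
    using eq yx nz[OF y] by (simp add: w'_def field_simps)
  have dn: "degree p \<le> n"
    unfolding p_def n_def by (rule degree_binom_poly_le)
  have "cmod (2 * Re y * w' - n) \<le> cmod (2 * Re y * w' - degree p) + cmod (complex_of_real (real n - degree p))"
    by (rule order_trans[OF _ norm_triangle_ineq4]) simp
  also have "\<dots> \<le> n"
    using norm_log_derivative_le[of p y, OF nz y] dn unfolding w'_def norm_of_real by simp
  finally have "cmod (2 * Re y * w' - n) \<le> n" .
  \<comment> \<open>Thus \<open>1 / (y - x)\<close> lies in the disc that contains the points
    \<open>1 / (y - r)\<close>, which means \<open>Re x * Re y \<le> 0\<close>.\<close>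
  moreover have "2 * Re y * w' - n = n * ((2 * Re y - (y - x)) / (y - x))"
    using yx unfolding w' by (simp add: field_simps)
  ultimately have "cmod (2 * Re y - (y - x)) \<le> cmod (y - x)"
    using n0 yx by (simp only: norm_mult norm_divide norm_of_nat) (simp add: divide_le_eq)
  then have "(cmod (2 * Re y - (y - x)))\<^sup>2 \<le> (cmod (y - x))\<^sup>2"
    by (simp add: power_mono)
  then have "Re x * Re y \<le> 0"
    unfolding cmod_power2 by (simp add: power2_eq_square algebra_simps)
  then show False
    using x y by (simp add: mult_le_0_iff)
qed

text \<open>Disposes of the surplus variables at a vertex: \<open>m\<close> of the
  \<open>n + m\<close> polarized variables receive the common value \<open>x\<close>.\<close>

lemma hurwitz_stable_polar_steps:
  assumes "hurwitz_stable (n + m) w" and "0 < Re x"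
  shows "hurwitz_stable n ((polar_step x ^^ m) w)"
  using assms(1)
proof (induction m arbitrary: n)
  case (Suc m)
  then show ?case
    using Suc.IH[of "Suc n"] hurwitz_stable_polar_step[OF _ assms(2)] by simp
qed simp

section \<open>Polarization over the half-edges\<close>

lemma sum_Pow_insert:
  assumes "finite I" and "i \<notin> I"
  shows "(\<Sum>S\<in>Pow (insert i I). f S) = (\<Sum>S\<in>Pow I. f S + f (insert i S))"
proof -
  have "inj_on (insert i) (Pow I)"
    using assms(2) by (auto simp: inj_on_def)
  moreover have "Pow I \<inter> insert i ` Pow I = {}"
    using assms(2) by auto
  ultimately show ?thesis
    using assms(1) by (simp add: Pow_insert sum.union_disjoint sum.reindex sum.distrib)
qed

text \<open>Grace--Walsh--Szego for a product of polarized polynomials, one factor per vertex: summing out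
  the variable \<open>x i\<close> is a polar step at the vertex \<open>h i\<close>.\<close>

lemma sum_prod_stable_nonzero:
  fixes w :: "'v \<Rightarrow> nat \<Rightarrow> complex"
  assumes "finite I" and "finite V" and "h ` I \<subseteq> V"
    and "\<And>v. v \<in> V \<Longrightarrow> hurwitz_stable (card {i \<in> I. h i = v}) (w v)"
    and "\<And>i. i \<in> I \<Longrightarrow> 0 < Re (x i)"
  shows "(\<Sum>S\<in>Pow I. (\<Prod>v\<in>V. w v (card {i \<in> S. h i = v})) * (\<Prod>i\<in>S. x i)) \<noteq> 0"
  using assms(1,3-)
proof (induction I arbitrary: w rule: finite_induct)
  case empty
  have "w v 0 \<noteq> 0" if "v \<in> V" for v
  proof -
    have "hurwitz_stable 0 (w v)"
      using empty.prems(2)[OF that] by simp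
    then have "poly (binom_poly 0 (w v)) 1 \<noteq> 0"
      unfolding hurwitz_stable_def by simp
    then show ?thesis
      by (simp add: poly_binom_poly)
  qed
  then show ?case
    using assms(2) by simp
next
  case (insert i I)
  define w' where "w' = w(h i := polar_step (x i) (w (h i)))"
  have hV: "h i \<in> V"
    using insert.prems(1) by simp
  have card: "card {j \<in> insert i S. h j = v} = card {j \<in> S. h j = v} + (if v = h i then 1 else 0)"
    if "S \<subseteq> I" for S v
  proof -
    have "{j \<in> insert i S. h j = v} = (if v = h i then insert i {j \<in> S. h j = v} else {j \<in> S. h j = v})"
      by auto
    moreover have "finite S" "i \<notin> S"
      using that insert.hyps finite_subset by auto
    ultimately show ?thesis
      by simp
  qed
  have "(\<Sum>S\<in>Pow I. (\<Prod>v\<in>V. w' v (card {i \<in> S. h i = v})) * (\<Prod>i\<in>S. x i)) \<noteq> 0"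
  proof (rule insert.IH)
    fix v assume v: "v \<in> V"
    show "hurwitz_stable (card {i \<in> I. h i = v}) (w' v)"
      using insert.prems(2)[OF v] insert.prems(3)[of i] card[of I v]
        hurwitz_stable_polar_step[of "card {i \<in> I. h i = v}" "w v" "x i"]
      by (auto simp: w'_def split: if_splits)
  qed (use insert.prems in auto)
  also have "(\<Sum>S\<in>Pow I. (\<Prod>v\<in>V. w' v (card {i \<in> S. h i = v})) * (\<Prod>i\<in>S. x i)) =
     (\<Sum>S\<in>Pow (insert i I). (\<Prod>v\<in>V. w v (card {i \<in> S. h i = v})) * (\<Prod>i\<in>S. x i))"
    unfolding sum_Pow_insert[OF insert.hyps]
  proof (rule sum.cong)
    fix S assume "S \<in> Pow I"
    then have S: "S \<subseteq> I" by simp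
    then have S': "finite S" "i \<notin> S"
      using insert.hyps finite_subset by auto
    have rest: "(\<Prod>v\<in>V. g v) = g (h i) * (\<Prod>v\<in>V - {h i}. g v)" for g :: "'v \<Rightarrow> complex"
      using prod.remove[OF assms(2) hV] .
    have 1: "(\<Prod>v\<in>V - {h i}. w v (card {j \<in> insert i S. h j = v})) =
             (\<Prod>v\<in>V - {h i}. w v (card {j \<in> S. h j = v}))"
      by (rule prod.cong) (use card[OF S] in auto)
    have 2: "(\<Prod>v\<in>V - {h i}. w' v (card {j \<in> S. h j = v})) =
             (\<Prod>v\<in>V - {h i}. w v (card {j \<in> S. h j = v}))"
      by (rule prod.cong) (auto simp: w'_def)
    show "(\<Prod>v\<in>V. w' v (card {i \<in> S. h i = v})) * (\<Prod>i\<in>S. x i) =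
        (\<Prod>v\<in>V. w v (card {i \<in> S. h i = v})) * (\<Prod>i\<in>S. x i) +
        (\<Prod>v\<in>V. w v (card {j \<in> insert i S. h j = v})) * (\<Prod>i\<in>insert i S. x i)"
      unfolding rest 1 2 card[OF S] using S'
      by (simp add: w'_def polar_step_def algebra_simps)
  qed simp
  finally show ?case .
qed

section \<open>Contraction of edges\<close>

text \<open>Lieb--Sokal: replacing \<open>y\<close> by \<open>y + d / (c + d x)\<close>, which stays in the right half-plane,
  adds \<open>d\<close> to the value.\<close>

lemma lieb_sokal:
  fixes a b c d :: complex
  assumes nz: "\<And>x y. \<lbrakk>0 < Re x; 0 < Re y\<rbrakk> \<Longrightarrow> a + b * x + c * y + d * (x * y) \<noteq> 0"
    and x: "0 < Re x" and y: "0 < Re y"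
  shows "a + b * x + c * y + d * (x * y + 1) \<noteq> 0"
proof (cases "d = 0")
  case True
  then show ?thesis using nz[OF x y] by simp
next
  case d: False
  \<comment> \<open>Otherwise the coefficient \<open>c + d * x\<close> of \<open>y\<close> vanishes
    at a point \<open>x0\<close> of the half-plane, and near \<open>x0\<close> there are zeros with
    \<open>y\<close> large.\<close>
  have "0 \<le> Re (c / d)"
  proof (rule ccontr)
    define x0 where "x0 = - (c / d)"
    assume "\<not> 0 \<le> Re (c / d)"
    then have x0: "0 < Re x0" by (simp add: x0_def)
    \<comment> \<open>Solving for \<open>y\<close> at \<open>x = x0 + \<delta> * k\<close> gives
      \<open>1 / \<delta> - b / d\<close>: this \<open>k\<close> makes the leading term real and
      positive. The two bounds on \<open>\<delta>\<close> keep \<open>Re x\<close> and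
      \<open>Re y\<close> positive.\<close>
    define k where "k = - (a + b * x0) / d"
    define \<delta> where "\<delta> = min (Re x0 / (2 * (1 + \<bar>Re k\<bar>))) (1 / (1 + \<bar>Re (b / d)\<bar>))"
    have \<delta>: "0 < \<delta>"
      unfolding \<delta>_def using x0 by simp
    have k: "k \<noteq> 0"
      using nz[OF x0, of 1] d by (auto simp: k_def x0_def field_simps)
    have "\<delta> \<le> Re x0 / 2 / (1 + \<bar>Re k\<bar>)"
      by (simp add: \<delta>_def)
    then have "\<delta> * (1 + \<bar>Re k\<bar>) \<le> Re x0 / 2"
      by (subst (asm) pos_le_divide_eq) auto
    moreover have "- (\<delta> * Re k) \<le> \<delta> * (1 + \<bar>Re k\<bar>)"
      using \<delta> mult_left_mono[of "- Re k" "1 + \<bar>Re k\<bar>" \<delta>] by simp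
    ultimately have X: "0 < Re (x0 + \<delta> * k)"
      using x0 by simp
    have "1 + \<bar>Re (b / d)\<bar> \<le> 1 / \<delta>"
      using \<delta> le_imp_inverse_le[of \<delta> "1 / (1 + \<bar>Re (b / d)\<bar>)"] 
      by (simp add: \<delta>_def inverse_eq_divide)
    then have Y: "0 < Re (1 / complex_of_real \<delta> - b / d)"
      by (simp add: Re_divide_of_real)
    have "a + b * (x0 + \<delta> * k) + c * (1 / \<delta> - b / d) + d * ((x0 + \<delta> * k) * (1 / \<delta> - b / d)) = 0"
      using d \<delta> by (simp add: x0_def k_def field_simps)
    then show False
      using nz[OF X Y] by simp
  qed
  then have pos: "0 < Re (c / d + x)"
    using x by simp
  then have cd: "c + d * x \<noteq> 0"
    using d by (auto simp: field_simps add_eq_0_iff)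
  have "0 < Re (inverse (c / d + x))"
    using pos unfolding inverse_complex.sel
    by (intro divide_pos_pos add_pos_nonneg) (simp_all add: power2_eq_square)
  then have "0 < Re (y + inverse (c / d + x))"
    using y by simp
  moreover have "inverse (c / d + x) = d / (c + d * x)"
    using d cd by (simp add: field_simps)
  ultimately have "a + b * x + c * (y + d / (c + d * x)) + d * (x * (y + d / (c + d * x))) \<noteq> 0"
    using nz[OF x] by simp
  also have "a + b * x + c * (y + d / (c + d * x)) + d * (x * (y + d / (c + d * x))) =
      a + b * x + c * y + d * (x * y) + (c + d * x) * (d / (c + d * x))"
    by (simp only: algebra_simps)
  also have "\<dots> = a + b * x + c * y + d * (x * y + 1)"
    using cd by (simp add: distrib_left)
  finally show ?thesis .
qed

text \<open>What the monomial in the two half-edge variables of an edge, each absent or present, becomes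
  under \<open>1 + \<partial>\<^sub>i \<partial>\<^sub>j\<close> followed by evaluation at \<open>\<epsilon>\<close>.\<close>

definition edge_weight :: "complex \<Rightarrow> bool \<Rightarrow> bool \<Rightarrow> complex" where
  "edge_weight \<epsilon> p q =
     (if p then \<epsilon> else 1) * (if q then \<epsilon> else 1) + (if p \<and> q then 1 else 0)"

lemma continuous_on_edge_weight:
  "continuous_on A f \<Longrightarrow> continuous_on A (\<lambda>x. edge_weight (f x) p q)"
  unfolding edge_weight_def
  by (cases p; cases q) (simp_all add: continuous_on_add continuous_on_mult)

lemma sum_Pow_edges_insert:
  assumes "finite A" and "e \<notin> A"
  shows "(\<Sum>S\<in>Pow (insert e A \<times> UNIV). f S) =
    (\<Sum>S\<in>Pow (A \<times> (UNIV :: bool set)). f S + f (insert (e, True) S) + f (insert (e, False) S)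
        + f (insert (e, True) (insert (e, False) S)))"
proof -
  have eq: "insert e A \<times> (UNIV :: bool set) = insert (e, True) (insert (e, False) (A \<times> UNIV))"
    by (auto simp: UNIV_bool)
  show ?thesis
    unfolding eq using assms
    by (simp add: sum_Pow_insert insert_commute add_ac)
qed

text \<open>In the two variables of one edge, all others fixed, the sum has the form
  \<open>a + b * X + c * Y + d * (X * Y)\<close>, so \<open>lieb_sokal\<close> applies. As the
  coefficients are arbitrary, what remains is an instance with one edge fewer.\<close>

lemma contract_edges_nonzero:
  fixes c :: "('e \<times> bool) set \<Rightarrow> complex"
  assumes "finite A"
    and "\<And>x. (\<And>i. 0 < Re (x i)) \<Longrightarrow> (\<Sum>S\<in>Pow (A \<times> UNIV). c S * (\<Prod>i\<in>S. x i)) \<noteq> 0"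
    and \<epsilon>: "0 < Re \<epsilon>"
  shows "(\<Sum>S\<in>Pow (A \<times> UNIV). c S * (\<Prod>e\<in>A. edge_weight \<epsilon> ((e, True) \<in> S) ((e, False) \<in> S))) \<noteq> 0"
  using assms(1,2)
proof (induction A arbitrary: c rule: finite_induct)
  case empty
  then show ?case using empty[of "\<lambda>_. 1"] by simp
next
  case (insert e A)
  let ?i = "(e, True)" and ?j = "(e, False)"
  \<comment> \<open>Contraction of \<open>e\<close> at \<open>\<epsilon>\<close> turns
    \<open>X * Y\<close> into \<open>\<epsilon> * \<epsilon> + 1\<close> and merely evaluates the
    other three monomials.\<close>
  define c' where "c' S = c S + c (insert ?i S) * \<epsilon> + c (insert ?j S) * \<epsilon>
    + c (insert ?i (insert ?j S)) * (\<epsilon> * \<epsilon> + 1)" for S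
  have "(\<Sum>S\<in>Pow (A \<times> UNIV). c' S *
      (\<Prod>e\<in>A. edge_weight \<epsilon> ((e, True) \<in> S) ((e, False) \<in> S))) \<noteq> 0"
  proof (rule insert.IH)
    fix x :: "'e \<times> bool \<Rightarrow> complex"
    assume x: "\<And>i. 0 < Re (x i)"
    let ?M = "\<lambda>f. \<Sum>S\<in>Pow (A \<times> UNIV). c (f S) * (\<Prod>i\<in>S. x i)"
    have "?M (\<lambda>S. S) + ?M (insert ?i) * \<epsilon> + ?M (insert ?j) * \<epsilon> +
        ?M (\<lambda>S. insert ?i (insert ?j S)) * (\<epsilon> * \<epsilon> + 1) \<noteq> 0"
    proof (rule lieb_sokal[OF _ \<epsilon> \<epsilon>])
      fix X Y :: complex
      assume XY: "0 < Re X" "0 < Re Y"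
      define x' where "x' = x(?i := X, ?j := Y)"
      have "(\<Sum>S\<in>Pow (insert e A \<times> UNIV). c S * (\<Prod>i\<in>S. x' i)) \<noteq> 0"
        by (rule insert.prems) (use x XY in \<open>auto simp: x'_def\<close>)
      also have "(\<Sum>S\<in>Pow (insert e A \<times> UNIV). c S * (\<Prod>i\<in>S. x' i)) =
        (\<Sum>S\<in>Pow (A \<times> UNIV). c S * (\<Prod>i\<in>S. x i) + c (insert ?i S) * (\<Prod>i\<in>S. x i) * X
           + c (insert ?j S) * (\<Prod>i\<in>S. x i) * Y
           + c (insert ?i (insert ?j S)) * (\<Prod>i\<in>S. x i) * (X * Y))"
        unfolding sum_Pow_edges_insert[OF insert.hyps]
      proof (rule sum.cong)
        fix S assume "S \<in> Pow (A \<times> (UNIV :: bool set))"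
        then have S: "finite S" "?i \<notin> S" "?j \<notin> S"
          using insert.hyps finite_subset[of S "A \<times> UNIV"] by auto
        then have "(\<Prod>i\<in>S. x' i) = (\<Prod>i\<in>S. x i)"
          by (intro prod.cong) (auto simp: x'_def)
        then show "c S * (\<Prod>i\<in>S. x' i) + c (insert ?i S) * (\<Prod>i\<in>insert ?i S. x' i)
            + c (insert ?j S) * (\<Prod>i\<in>insert ?j S. x' i)
            + c (insert ?i (insert ?j S)) * (\<Prod>i\<in>insert ?i (insert ?j S). x' i) =
          c S * (\<Prod>i\<in>S. x i) + c (insert ?i S) * (\<Prod>i\<in>S. x i) * X
           + c (insert ?j S) * (\<Prod>i\<in>S. x i) * Y
           + c (insert ?i (insert ?j S)) * (\<Prod>i\<in>S. x i) * (X * Y)"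
          using S by (simp add: x'_def)
      qed simp
      finally show "?M (\<lambda>S. S) + ?M (insert ?i) * X + ?M (insert ?j) * Y +
        ?M (\<lambda>S. insert ?i (insert ?j S)) * (X * Y) \<noteq> 0"
        by (simp add: sum.distrib sum_distrib_right)
    qed
    then show "(\<Sum>S\<in>Pow (A \<times> UNIV). c' S * (\<Prod>i\<in>S. x i)) \<noteq> 0"
      unfolding c'_def distrib_right sum.distrib sum_distrib_right
      by (simp only: mult_ac not_False_eq_True)
  qed
  also have "(\<Sum>S\<in>Pow (A \<times> UNIV). c' S *
      (\<Prod>e\<in>A. edge_weight \<epsilon> ((e, True) \<in> S) ((e, False) \<in> S))) =
    (\<Sum>S\<in>Pow (insert e A \<times> UNIV). c S *
      (\<Prod>e\<in>insert e A. edge_weight \<epsilon> ((e, True) \<in> S) ((e, False) \<in> S)))"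
    unfolding sum_Pow_edges_insert[OF insert.hyps]
  proof (rule sum.cong)
    fix S assume "S \<in> Pow (A \<times> (UNIV :: bool set))"
    then have S: "?i \<notin> S" "?j \<notin> S"
      using insert.hyps by auto
    let ?P = "\<lambda>T. \<Prod>f\<in>A. edge_weight \<epsilon> ((f, True) \<in> T) ((f, False) \<in> T)"
    have ne: "f \<noteq> e" if "f \<in> A" for f
      using insert.hyps that by blast
    have rest: "?P (insert ?i S) = ?P S" "?P (insert ?j S) = ?P S"
      "?P (insert ?i (insert ?j S)) = ?P S"
      by (auto intro!: prod.cong dest: ne)
    have weight: "edge_weight \<epsilon> False False = 1" "edge_weight \<epsilon> True False = \<epsilon>"
      "edge_weight \<epsilon> False True = \<epsilon>" "edge_weight \<epsilon> True True = \<epsilon> * \<epsilon> + 1"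
      by (simp_all add: edge_weight_def)
    show "c' S * (\<Prod>e\<in>A. edge_weight \<epsilon> ((e, True) \<in> S) ((e, False) \<in> S)) =
      c S * (\<Prod>e\<in>insert e A. edge_weight \<epsilon> ((e, True) \<in> S) ((e, False) \<in> S)) +
      c (insert ?i S) * (\<Prod>e\<in>insert e A. edge_weight \<epsilon> ((e, True) \<in> insert ?i S) ((e, False) \<in> insert ?i S)) +
      c (insert ?j S) * (\<Prod>e\<in>insert e A. edge_weight \<epsilon> ((e, True) \<in> insert ?j S) ((e, False) \<in> insert ?j S)) +
      c (insert ?i (insert ?j S)) * (\<Prod>e\<in>insert e A. edge_weight \<epsilon> ((e, True) \<in> insert ?i (insert ?j S)) ((e, False) \<in> insert ?i (insert ?j S)))"
      unfolding prod.insert[OF insert.hyps]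
        rest c'_def
      using S by (simp add: weight distrib_right mult.assoc)
  qed simp
  finally show ?case .
qed

section \<open>Passage to the limit\<close>

text \<open>Hurwitz's theorem along \<open>\<epsilon> = 1 / Suc n\<close>. Joint continuity
  supplies, for compact \<open>K\<close>, one neighbourhood of 0 that serves all
  \<open>z \<in> K\<close>, hence uniform convergence on \<open>K\<close>.\<close>

lemma nonzero_limit_of_nonzero:
  fixes F :: "real \<Rightarrow> complex \<Rightarrow> complex"
  assumes S: "open S" "connected S"
    and hol: "\<And>\<epsilon>. F \<epsilon> holomorphic_on S"
    and cont: "continuous_on UNIV (\<lambda>(\<epsilon>, z). F \<epsilon> z)"
    and nz: "\<And>\<epsilon> z. 0 < \<epsilon> \<Longrightarrow> z \<in> S \<Longrightarrow> F \<epsilon> z \<noteq> 0"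
    and nonconst: "\<not> F 0 constant_on S"
    and z: "z \<in> S"
  shows "F 0 z \<noteq> 0"
proof (rule Hurwitz_no_zeros[OF S, of "\<lambda>n. F (1 / Suc n)" "F 0"])
  fix K assume K: "compact K" "K \<subseteq> S"
  show "uniform_limit K (\<lambda>n. F (1 / Suc n)) (F 0) sequentially"
  proof (rule uniform_limitI)
    fix e :: real assume e: "0 < e"
    have "continuous_on (UNIV \<times> K) (\<lambda>(\<epsilon>, z). F \<epsilon> z)"
      by (rule continuous_on_subset[OF cont]) auto
    then obtain X where X: "0 \<in> X" "open X"
      "\<And>\<epsilon> z. \<epsilon> \<in> X \<Longrightarrow> z \<in> K \<Longrightarrow> dist (F \<epsilon> z) (F 0 z) \<le> e / 2"
      by (rule continuous_on_prod_compactE[of UNIV K "\<lambda>(\<epsilon>, z). F \<epsilon> z" 0 "e / 2"])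
        (use K(1) e in auto)
    have "(\<lambda>n. 1 / real (Suc n)) \<longlonglongrightarrow> 0"
      using LIMSEQ_inverse_real_of_nat by (simp add: inverse_eq_divide)
    then have "\<forall>\<^sub>F n in sequentially. 1 / real (Suc n) \<in> X"
      using X(1,2) topological_tendstoD by blast
    then show "\<forall>\<^sub>F n in sequentially. \<forall>z\<in>K. dist (F (1 / real (Suc n)) z) (F 0 z) < e"
    proof eventually_elim
      case (elim n)
      show ?case
      proof
        fix z assume "z \<in> K"
        with elim have "dist (F (1 / real (Suc n)) z) (F 0 z) \<le> e / 2"
          by (rule X(3))
        then show "dist (F (1 / real (Suc n)) z) (F 0 z) < e"
          using e by linarith
      qed
    qed
  qed
qed (use hol nz nonconst z in auto)

lemma polar_step_0: "polar_step 0 = id"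
  by (auto simp: polar_step_def fun_eq_iff)

lemma continuous_on_polar_steps:
  assumes "continuous_on A f" and "\<And>k. continuous_on A (\<lambda>p. g p k)"
  shows "continuous_on A (\<lambda>p. (polar_step (f p) ^^ m) (g p) k)"
proof (induction m arbitrary: k)
  case (Suc m)
  show ?case
    unfolding funpow.simps comp_def polar_step_def[of _ "(polar_step _ ^^ m) _"]
    by (intro continuous_on_add continuous_on_mult assms(1) Suc.IH)
qed (simp add: assms)

lemma holomorphic_on_polar_steps:
  assumes "\<And>k. (\<lambda>z. g z k) holomorphic_on A"
  shows "(\<lambda>z. (polar_step x ^^ m) (g z) k) holomorphic_on A"
proof (induction m arbitrary: k)
  case (Suc m)
  show ?case
    unfolding funpow.simps comp_def polar_step_def[of _ "(polar_step _ ^^ m) _"]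
    by (intro holomorphic_on_add holomorphic_on_mult holomorphic_on_const Suc.IH)
qed (simp add: assms)

section \<open>Sectors\<close>

text \<open>These weights amount to evaluating \<open>Gamma_poly n u\<close> at
  \<open>s * y\<close>. The arguments of \<open>s\<close> and \<open>y\<close> sum to less than
  \<open>pi - \<alpha> \<le> pi\<close> in absolute value, so they add without wrap-around.\<close>

lemma hurwitz_stable_sector:
  assumes nv: "nonvanishing (sector (pi - \<alpha>)) (Gamma_poly n u)" and "Gamma_poly n u \<noteq> 0"
    and \<alpha>: "0 \<le> \<alpha>" and s: "s \<in> sector (pi / 2 - \<alpha>)"
  shows "hurwitz_stable n (\<lambda>k. s ^ k * complex_of_real (u k))"
  unfolding hurwitz_stable_def
proof (intro allI impI)
  fix y :: complex assume y: "0 < Re y"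
  have "\<bar>Arg y\<bar> < pi / 2" and "y \<noteq> 0"
    using y Arg_Re_pos by auto
  then have "s * y \<in> sector (pi - \<alpha>)"
    using s \<alpha> unfolding sector_def by (subst mem_Collect_eq, subst Arg_times) auto
  then have "poly (Gamma_poly n u) (s * y) \<noteq> 0"
    using assms(1,2) by (auto simp: nonvanishing_def)
  then show "poly (binom_poly n (\<lambda>k. s ^ k * complex_of_real (u k))) y \<noteq> 0"
    by (simp add: poly_binom_poly Gamma_poly_def poly_sum poly_monom power_mult_distrib mult_ac)
qed

text \<open>\<open>Arg\<close> is continuous off the nonpositive reals, which the sector avoids
  because \<open>\<theta> \<le> pi\<close>.\<close>

lemma open_sector: "\<theta> \<le> pi \<Longrightarrow> open (sector \<theta>)"
proof -
  assume \<theta>: "\<theta> \<le> pi"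
  have "sector \<theta> = (- \<real>\<^sub>\<le>\<^sub>0) \<inter> (\<lambda>z. \<bar>Arg z\<bar>) -` {..<\<theta>}"
  proof -
    have "Arg z = pi" if "z \<in> \<real>\<^sub>\<le>\<^sub>0" "z \<noteq> 0" for z
      using that by (auto elim!: nonpos_Reals_cases)
    then show ?thesis
      using \<theta> unfolding sector_def by fastforce
  qed
  also have "open \<dots>"
    by (rule continuous_open_preimage) (auto intro!: continuous_intros)
  finally show ?thesis .
qed

section \<open>Edge subsets and their half-edges\<close>

lemma poly_count_poly:
  assumes "finite (edges G)"
  shows "poly (count_poly G u) t =
    (\<Sum>H\<in>Pow (edges G). complex_of_real (degree_weight G u H) * t ^ card H)"
proof -
  have "poly (count_poly G u) t =
    (\<Sum>j\<le>card (edges G). \<Sum>H | H \<in> Pow (edges G) \<and> card H = j.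
       complex_of_real (degree_weight G u H) * t ^ card H)"
    by (simp add: count_poly_def poly_sum poly_monom weighted_count_def sum_distrib_right)
  also have "\<dots> = (\<Sum>H\<in>Pow (edges G). complex_of_real (degree_weight G u H) * t ^ card H)"
    by (rule sum.group) (use assms card_mono in auto)
  finally show ?thesis .
qed

text \<open>Count first and second ends separately; inclusion-exclusion turns the total into
  incident edges plus loops, the two summands of \<open>sub_degree\<close>.\<close>

lemma card_half_edges_at:
  fixes a :: "'e \<times> bool \<Rightarrow> 'v"
  assumes "\<And>e. e \<in> H \<Longrightarrow> ends G e = Upair (a (e, True)) (a (e, False))" and "finite H"
  shows "card {i \<in> H \<times> UNIV. a i = v} = sub_degree G H v"
proof -
  let ?T = "{e \<in> H. a (e, True) = v}" and ?F = "{e \<in> H. a (e, False) = v}"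
  have "{i \<in> H \<times> UNIV. a i = v} = (\<lambda>e. (e, True)) ` ?T \<union> (\<lambda>e. (e, False)) ` ?F"
    by (auto simp: image_iff) (metis (full_types))+
  then have "card {i \<in> H \<times> UNIV. a i = v} =
      card ((\<lambda>e. (e, True)) ` ?T) + card ((\<lambda>e. (e, False)) ` ?F)"
    using assms(2) by (simp only:, intro card_Un_disjoint) auto
  also have "\<dots> = card ?T + card ?F"
    by (simp add: card_image inj_on_def)
  also have "\<dots> = card (?T \<union> ?F) + card (?T \<inter> ?F)"
    using assms(2) by (intro card_Un_Int) auto
  also have "?T \<union> ?F = {e \<in> H. v \<in> set_uprod (ends G e)}"
    using assms(1) by auto
  also have "?T \<inter> ?F = {e \<in> H. ends G e = Upair v v}"
    using assms(1) by auto
  finally show ?thesis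
    by (simp add: sub_degree_def)
qed

lemma prod_power_card_fibres:
  assumes "finite I" "finite V" "h ` I \<subseteq> V"
  shows "(\<Prod>v\<in>V. s ^ card {i \<in> I. h i = v}) = (s :: complex) ^ card I"
proof -
  have "(\<Prod>v\<in>V. s ^ card {i \<in> I. h i = v}) = (\<Prod>v\<in>V. \<Prod>i | i \<in> I \<and> h i = v. s)"
    by simp
  also have "\<dots> = (\<Prod>i\<in>I. s)"
    by (rule prod.group) (use assms in auto)
  finally show ?thesis by simp
qed

section \<open>Nonvanishing of the edge-counting polynomial\<close>

theorem corollary19:
  fixes G :: "('v, 'e) ugraph"
    and D :: "'v \<Rightarrow> nat"
    and u :: "'v \<Rightarrow> nat \<Rightarrow> real"
    and \<alpha> :: real
  assumes "finite_multigraph G"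
    and "\<And>v. v \<in> verts G \<Longrightarrow> sub_degree G (edges G) v \<le> D v"
    and "0 \<le> \<alpha>" and "\<alpha> < pi / 2"
    and "\<And>v k. v \<in> verts G \<Longrightarrow> 0 \<le> u v k"
    and "\<And>v. v \<in> verts G \<Longrightarrow> nonvanishing (sector (pi - \<alpha>)) (Gamma_poly (D v) (u v))"
  shows "nonvanishing (sector (pi - 2 * \<alpha>)) (count_poly G u)"
proof -
  interpret finite_multigraph G by fact
  let ?V = "verts G" and ?E = "edges G"
  let ?d = "sub_degree G ?E"
  have "\<exists>p. ends G e = Upair (fst p) (snd p)" for e
    by (cases "ends G e" rule: uprod_exhaust) (metis fst_conv snd_conv)
  then obtain p where p: "ends G e = Upair (fst (p e)) (snd (p e))" for e
    by metis
  \<comment> \<open>An arbitrary order of the two ends attaches each half-edge to a vertex; both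
    halves of a loop go to the same one.\<close>
  define a where "a = (\<lambda>(e, b). if b then fst (p e) else snd (p e))"
  have a: "ends G e = Upair (a (e, True)) (a (e, False))" for e
    using p by (simp add: a_def)
  have aV: "a ` (H \<times> UNIV) \<subseteq> ?V" if "H \<subseteq> ?E" for H
  proof
    fix v assume "v \<in> a ` (H \<times> UNIV)"
    then obtain e b where eb: "e \<in> H" "v = a (e, b)" by auto
    then have "v \<in> set_uprod (ends G e)"
      unfolding a by (cases b) auto
    then show "v \<in> ?V"
      using ends_in_verts eb(1) that by blast
  qed
  have fin: "finite H" if "H \<subseteq> ?E" for H
    using finite_edges finite_subset that by blast
  have deg: "card {i \<in> H \<times> UNIV. a i = v} = sub_degree G H v" if "H \<subseteq> ?E" for H v
    by (rule card_half_edges_at) (use a fin that in auto)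
  show ?thesis
  proof (cases "\<exists>v\<in>?V. Gamma_poly (D v) (u v) = 0")
    \<comment> \<open>The zero polynomial counts as nonvanishing, but then \<open>u v k = 0\<close>
      for all \<open>k \<le> D v\<close>. Every degree at \<open>v\<close> is in this range, so
      \<open>count_poly G u\<close> is zero too.\<close>
    case True
    then obtain v where v: "v \<in> ?V" "Gamma_poly (D v) (u v) = 0" by blast
    have u0: "u v k = 0" if "k \<le> D v" for k
    proof -
      have "coeff (Gamma_poly (D v) (u v)) k = of_nat (D v choose k) * complex_of_real (u v k)"
        using that by (simp add: Gamma_poly_def coeff_sum)
      then show ?thesis using v(2) that by simp
    qed
    have "degree_weight G u H = 0" if "H \<subseteq> ?E" for H
    proof -
      have "sub_degree G H v \<le> ?d v"
        unfolding sub_degree_def using that finite_edges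
        by (intro add_mono card_mono) auto
      then have "u v (sub_degree G H v) = 0"
        using assms(2)[OF v(1)] u0 by simp
      then show ?thesis
        unfolding degree_weight_def using v(1) finite_verts by auto
    qed
    then have "weighted_count G u j = 0" for j
      by (simp add: weighted_count_def)
    then show ?thesis
      by (simp add: nonvanishing_def count_poly_def)
  next
    case False
    define F where "F \<epsilon> s =
      (\<Sum>S\<in>Pow (?E \<times> UNIV).
        (\<Prod>v\<in>?V. (polar_step (complex_of_real \<epsilon>) ^^ (D v - ?d v))
           (\<lambda>k. s ^ k * complex_of_real (u v k)) (card {i \<in> S. a i = v})) *
        (\<Prod>e\<in>?E. edge_weight (complex_of_real \<epsilon>) ((e, True) \<in> S) ((e, False) \<in> S)))"
      for \<epsilon> s
    have F_nz: "F \<epsilon> s \<noteq> 0" if \<epsilon>: "0 < \<epsilon>" and s: "s \<in> sector (pi / 2 - \<alpha>)" for \<epsilon> s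
      unfolding F_def
    proof (rule contract_edges_nonzero[OF finite_edges])
      fix x :: "'e \<times> bool \<Rightarrow> complex"
      assume x: "\<And>i. 0 < Re (x i)"
      show "(\<Sum>S\<in>Pow (?E \<times> UNIV). (\<Prod>v\<in>?V. (polar_step (complex_of_real \<epsilon>) ^^ (D v - ?d v))
           (\<lambda>k. s ^ k * complex_of_real (u v k)) (card {i \<in> S. a i = v})) * (\<Prod>i\<in>S. x i)) \<noteq> 0"
      proof (rule sum_prod_stable_nonzero)
        fix v assume v: "v \<in> ?V"
        have "hurwitz_stable (D v) (\<lambda>k. s ^ k * complex_of_real (u v k))"
          by (rule hurwitz_stable_sector) (use assms False v s in auto)
        then show "hurwitz_stable (card {i \<in> ?E \<times> UNIV. a i = v})
           ((polar_step (complex_of_real \<epsilon>) ^^ (D v - ?d v)) (\<lambda>k. s ^ k * complex_of_real (u v k)))"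
          unfolding deg[OF order_refl] using assms(2)[OF v] \<epsilon>
          by (intro hurwitz_stable_polar_steps) auto
      qed (use finite_edges finite_verts aV x in auto)
    qed (use \<epsilon> in simp)
    have F_0: "F 0 s = poly (count_poly G u) (s\<^sup>2)" for s
    proof -
      let ?w = "\<lambda>S. \<Prod>v\<in>?V. s ^ card {i \<in> S. a i = v} * complex_of_real (u v (card {i \<in> S. a i = v}))"
      let ?m = "\<lambda>S. \<Prod>e\<in>?E. edge_weight 0 ((e, True) \<in> S) ((e, False) \<in> S)"
      have "F 0 s = (\<Sum>S\<in>Pow (?E \<times> UNIV). ?w S * ?m S)"
        by (simp add: F_def polar_step_0)
      \<comment> \<open>\<open>edge_weight 0\<close> is 0 if just one half of the edge is present
        and 1 otherwise, so only unions of complete edges survive.\<close>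
      also have "\<dots> = (\<Sum>S\<in>(\<lambda>H. H \<times> UNIV) ` Pow ?E. ?w S * ?m S)"
      proof (rule sum.mono_neutral_right)
        show "\<forall>S\<in>Pow (?E \<times> UNIV) - (\<lambda>H. H \<times> UNIV) ` Pow ?E. ?w S * ?m S = 0"
        proof
          fix S assume S: "S \<in> Pow (?E \<times> (UNIV :: bool set)) - (\<lambda>H. H \<times> UNIV) ` Pow ?E"
          have "\<exists>e\<in>?E. ((e, True) \<in> S) \<noteq> ((e, False) \<in> S)"
          proof (rule ccontr)
            assume *: "\<not> (\<exists>e\<in>?E. ((e, True) \<in> S) \<noteq> ((e, False) \<in> S))"
            have "(e, c) \<in> S" if "(e, b) \<in> S" for e b c
              using that S * by (cases b; cases c) auto
            then have "S = fst ` S \<times> UNIV"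
              by force
            moreover have "fst ` S \<subseteq> ?E"
              using S by auto
            ultimately show False
              using S by blast
          qed
          then have "\<exists>e\<in>?E. edge_weight 0 ((e, True) \<in> S) ((e, False) \<in> S) = 0"
            by (auto simp: edge_weight_def)
          then show "?w S * ?m S = 0"
            using finite_edges by simp
        qed
      qed (use finite_edges in auto)
      also have "\<dots> = (\<Sum>H\<in>Pow ?E. ?w (H \<times> UNIV) * ?m (H \<times> UNIV))"
        by (subst sum.reindex) (auto simp: inj_on_def)
      also have "\<dots> = (\<Sum>H\<in>Pow ?E. complex_of_real (degree_weight G u H) * (s\<^sup>2) ^ card H)"
      proof (rule sum.cong)
        fix H assume "H \<in> Pow ?E"
        then have H: "H \<subseteq> ?E" by simp
        have "?m (H \<times> UNIV) = 1"
          by (rule prod.neutral) (simp add: edge_weight_def)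
        \<comment> \<open>\<open>H\<close> has twice as many half-edges as edges, whence the power
          of \<open>s\<^sup>2\<close>.\<close>
        moreover have "?w (H \<times> UNIV) =
            s ^ card (H \<times> (UNIV :: bool set)) * complex_of_real (degree_weight G u H)"
          unfolding prod.distrib degree_weight_def of_real_prod deg[OF H, symmetric]
          by (subst prod_power_card_fibres) (use finite_verts fin H aV in auto)
        ultimately show "?w (H \<times> UNIV) * ?m (H \<times> UNIV) =
            complex_of_real (degree_weight G u H) * (s\<^sup>2) ^ card H"
          by (simp add: card_cartesian_product mult.commute flip: power_mult)
      qed simp
      finally show ?thesis
        by (simp add: poly_count_poly finite_edges)
    qed
    show ?thesis
    \<comment> \<open>Hurwitz's theorem needs a nonconstant limit; a constant polynomial is zero or
      vanishes nowhere.\<close>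
    proof (cases "degree (count_poly G u) = 0")
      case nonconst: False
      have "poly (count_poly G u) t \<noteq> 0" if t: "t \<in> sector (pi - 2 * \<alpha>)" for t
      proof -
        \<comment> \<open>The principal square root halves \<open>Arg\<close>.\<close>
        have "csqrt t \<in> sector (pi / 2 - \<alpha>)"
          using t by (auto simp: sector_def field_simps)
        moreover have "open (sector (pi / 2 - \<alpha>))"
          using assms(3) pi_gt_zero by (intro open_sector) linarith
        ultimately obtain r where r: "0 < r" "ball (csqrt t) r \<subseteq> sector (pi / 2 - \<alpha>)"
          using open_contains_ball by blast
        have "F 0 (csqrt t) \<noteq> 0"
        proof (rule nonzero_limit_of_nonzero[of "ball (csqrt t) r" F])
          show "F \<epsilon> holomorphic_on ball (csqrt t) r" for \<epsilon>
            unfolding F_def by (intro holomorphic_intros holomorphic_on_polar_steps)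
          show "continuous_on UNIV (\<lambda>(\<epsilon>, z). F \<epsilon> z)"
            unfolding F_def case_prod_beta
            by (intro continuous_intros continuous_on_polar_steps continuous_on_edge_weight)
          show "F \<epsilon> z \<noteq> 0" if "0 < \<epsilon>" "z \<in> ball (csqrt t) r" for \<epsilon> z
            using F_nz that r(2) by blast
          show "\<not> F 0 constant_on ball (csqrt t) r"
          proof
            assume "F 0 constant_on ball (csqrt t) r"
            then obtain c where c: "\<And>z. z \<in> ball (csqrt t) r \<Longrightarrow> F 0 z = c"
              unfolding constant_on_def by blast
            \<comment> \<open>If \<open>F 0\<close> were constant on the ball, \<open>q\<close>
              would have infinitely many roots and be zero; but substituting the square of the
              variable doubles the positive degree of \<open>count_poly G u\<close>.\<close>
            define q where "q = pcompose (count_poly G u) [:0, 0, 1:] - [:c:]"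
            have "ball (csqrt t) r \<subseteq> {z. poly q z = 0}"
              using c unfolding F_0 by (auto simp: q_def poly_pcompose power2_eq_square)
            then have "\<not> finite {z. poly q z = 0}"
              using uncountable_ball[of r "csqrt t"] r(1) finite_subset countable_finite by blast
            then have "q = 0"
              using poly_roots_finite by blast
            then have "degree (pcompose (count_poly G u) [:0, 0, 1:]) = 0"
              by (simp add: q_def)
            then show False
              using nonconst by (simp add: degree_pcompose)
          qed
        qed (use r in auto)
        then show ?thesis
          by (simp add: F_0)
      qed
      then show ?thesis by (simp add: nonvanishing_def)
    next
      case True
      then obtain c where "count_poly G u = [:c:]"
        by (rule degree_eq_zeroE)
      then show ?thesis
        by (simp add: nonvanishing_def)
    qed
  qed
qed

end
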